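(* Let $\mathcal M$ be a convex class of probability distributions on a measurable space $\mathcal X$ containing at least two distinct distributions, and fix $T\in\mathbb N$. 1. Fix $\alpha\in[0,1)$ and let $\tau$ be a stopping time satisfying $\sup_{P\in\mathcal M}\mathbb P_{P,\infty}(\tau<\infty)\le\alpha$. Then, for every $P_0\in\mathcal M$, $$\inf_{P_1\in\mathcal M\setminus\{P_0\}}\mathbb P_{P_0,T,P_1}(\tau<\infty)\le\alpha.$$ Moreover, for every $P_0,P_1\in\mathcal M$ such that $P_1\ll P_0$, $\mathbb P_{P_0,T,P_1}(\tau<\infty)<1$. 2. Let $(E_n)_{n\ge0}$ be a nonnegative adapted process satisfying $\mathbb E_{P,\infty}[E_\sigma]\le1$ for every $P\in\mathcal M$ and every bounded stopping time $\sigma$. Then, for every $P_0,P_1\in\mathcal M$ such that $P_0\ll P_1$, $$\mathbb P_{P_0,T,P_1}\Big(\sup_{n\ge0}E_n<\infty\Big)=1.$$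
   Context: The observations $X_1,X_2,\dots$ are $\mathcal X$-valued and the randomizers $\lambda_1,\lambda_2,\dots$ are iid $U(0,1)$, independent of the observations; work on the canonical space of $((X_n,\lambda_n))_{n\ge1}$. Under $\mathbb P_{P_0,T,P_1}$ the observations are independent with $X_1,\dots,X_T\sim P_0$ and $X_{T+1},X_{T+2},\dots\sim P_1$; under $\mathbb P_{P,\infty}$ (expectation $\mathbb E_{P,\infty}$) they are all iid with law $P$. The law of the randomizers is the same under all these measures. Stopping times (with values in $\{0,1,2,\dots\}\cup\{\infty\}$) and adaptedness are with respect to a fixed filtration on this space (e.g. the filtration generated by the data and randomizers, or any sub-filtration of it). *)

theory Defs
  imports "HOL-Probability.Probability"
begin

text \<open>The mixture \<open>t P + (1 - t) Q\<close>; meaningful for \<open>P\<close>, \<open>Q\<close> on the same measurable space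
  and \<open>0 \<le> t \<le> 1\<close>.\<close>

definition mixture :: "real \<Rightarrow> 'a measure \<Rightarrow> 'a measure \<Rightarrow> 'a measure" where
  "mixture t P Q = measure_of (space P) (sets P)
     (\<lambda>A. ennreal t * emeasure P A + ennreal (1 - t) * emeasure Q A)"

lemma space_mixture [simp]: "space (mixture t P Q) = space P"
  by (simp add: mixture_def)

lemma sets_mixture [simp]: "sets (mixture t P Q) = sets P"
  by (simp add: mixture_def)

lemma emeasure_mixture:
  assumes "sets Q = sets P" "A \<in> sets P"
  shows "emeasure (mixture t P Q) A = ennreal t * emeasure P A + ennreal (1 - t) * emeasure Q A"
  unfolding mixture_def
proof (rule emeasure_measure_of_sigma)
  show "sigma_algebra (space P) (sets P)" ..
  show "positive (sets P) (\<lambda>A. ennreal t * emeasure P A + ennreal (1 - t) * emeasure Q A)"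
    by (simp add: positive_def)
  show "countably_additive (sets P)
      (\<lambda>A. ennreal t * emeasure P A + ennreal (1 - t) * emeasure Q A)"
    using assms(1)
    by (auto simp: countably_additive_def suminf_add[symmetric] suminf_emeasure)
qed (use assms in simp)

definition convex_class :: "'a measure set \<Rightarrow> bool" where
  "convex_class \<M> \<longleftrightarrow> (\<forall>P\<in>\<M>. \<forall>Q\<in>\<M>. \<forall>t\<in>{0..1}. mixture t P Q \<in> \<M>)"

text \<open>A point of the canonical space is a sequence \<open>((x\<^sub>n, \<lambda>\<^sub>n))\<close> indexed by \<open>n \<ge> 1\<close>; each
  randomizer takes values in \<open>\<real>\<close> and has law U(0,1). Only the \<open>\<sigma>\<close>-algebra of
  \<open>canonical_space\<close> is relevant, not the measure it carries.\<close>

definition uniform01 :: "real measure" where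
  "uniform01 = uniform_measure lborel {0<..<1}"

definition canonical_space :: "'a measure \<Rightarrow> (nat \<Rightarrow> 'a \<times> real) measure" where
  "canonical_space X = PiM {1..} (\<lambda>_. X \<Otimes>\<^sub>M borel)"

definition change_law :: "'a measure \<Rightarrow> nat \<Rightarrow> 'a measure \<Rightarrow> (nat \<Rightarrow> 'a \<times> real) measure" where
  "change_law P0 T P1 = PiM {1..} (\<lambda>n. (if n \<le> T then P0 else P1) \<Otimes>\<^sub>M uniform01)"

definition iid_law :: "'a measure \<Rightarrow> (nat \<Rightarrow> 'a \<times> real) measure" where
  "iid_law P = PiM {1..} (\<lambda>_. P \<Otimes>\<^sub>M uniform01)"

text \<open>The library's \<open>stopping_time\<close> requires the filtration and the stopping time to share one
  index type; this is the version for a filtration indexed by \<open>nat\<close> and a time that may be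
  infinite.\<close>

definition ext_stopping_time :: "(nat \<Rightarrow> 'b measure) \<Rightarrow> ('b \<Rightarrow> enat) \<Rightarrow> bool" where
  "ext_stopping_time F \<tau> \<longleftrightarrow> (\<forall>n. Measurable.pred (F n) (\<lambda>\<omega>. \<tau> \<omega> \<le> enat n))"

end

theory Submission
  imports Defs
begin

text \<open>Both hypotheses constrain the iid laws only, so everything rests on comparing
  \<open>change_law P\<^sub>0 T P\<^sub>1\<close> with the iid law of \<open>P\<^sub>1\<close>. The two differ in
  only \<open>T\<close> coordinates, so \<open>P\<^sub>0 \<le> c P\<^sub>1\<close> implies
  \<open>change_law P\<^sub>0 T P\<^sub>1 \<le> c\<^sup>T iid_law P\<^sub>1\<close>.
  For the first claim take \<open>P\<^sub>1 = t P\<^sub>0 + (1 - t) Q\<close> with \<open>Q \<noteq> P\<^sub>0\<close>, so that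
  \<open>c = 1 / t\<close>, and let \<open>t\<close> tend to 1. For the other claims, absolute continuity is the case
  \<open>c = \<infinity>\<close>: a null set of one law is a null set of the other, which is applied
  to \<open>\<tau> = \<infinity>\<close> and, after Ville's inequality under the iid law of \<open>P\<^sub>1\<close>, to \<open>sup E\<^sub>n = \<infinity>\<close>.\<close>

section \<open>Domination of measures up to a constant factor\<close>

text \<open>The constant \<open>c\<close> may be \<open>\<infinity>\<close>; since \<open>\<infinity> * 0 = 0\<close> in \<open>ennreal\<close>, this case expresses
  absolute continuity.\<close>

definition dominated :: "ennreal \<Rightarrow> 'b measure \<Rightarrow> 'b measure \<Rightarrow> bool" where
  "dominated c \<nu> \<mu> \<longleftrightarrow> sets \<nu> = sets \<mu> \<and> (\<forall>A\<in>sets \<mu>. emeasure \<nu> A \<le> c * emeasure \<mu> A)"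

lemma dominatedI:
  "sets \<nu> = sets \<mu> \<Longrightarrow> (\<And>A. A \<in> sets \<mu> \<Longrightarrow> emeasure \<nu> A \<le> c * emeasure \<mu> A) \<Longrightarrow> dominated c \<nu> \<mu>"
  by (auto simp: dominated_def)

lemma dominated_sets: "dominated c \<nu> \<mu> \<Longrightarrow> sets \<nu> = sets \<mu>"
  and dominatedD: "dominated c \<nu> \<mu> \<Longrightarrow> A \<in> sets \<mu> \<Longrightarrow> emeasure \<nu> A \<le> c * emeasure \<mu> A"
  by (auto simp: dominated_def)

lemma dominated_refl: "dominated 1 \<mu> \<mu>"
  by (simp add: dominated_def)

lemma dominated_trans:
  assumes "dominated c \<nu> \<mu>" "dominated d \<mu> \<kappa>"
  shows "dominated (c * d) \<nu> \<kappa>"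
proof (rule dominatedI)
  show "sets \<nu> = sets \<kappa>"
    using assms by (simp add: dominated_def)
  fix A assume "A \<in> sets \<kappa>"
  then have "emeasure \<nu> A \<le> c * emeasure \<mu> A" "emeasure \<mu> A \<le> d * emeasure \<kappa> A"
    using assms by (auto simp: dominated_def)
  then show "emeasure \<nu> A \<le> c * d * emeasure \<kappa> A"
    by (metis mult.assoc mult_left_mono order_trans zero_le)
qed

text \<open>The argument orders differ: \<open>absolutely_continuous\<close> names the dominating
  measure first, \<open>dominated\<close> last.\<close>

lemma dominated_top_if_absolutely_continuous:
  assumes "absolutely_continuous \<mu> \<nu>" "sets \<nu> = sets \<mu>"
  shows "dominated \<infinity> \<nu> \<mu>"
proof (rule dominatedI)
  fix A assume "A \<in> sets \<mu>"
  then show "emeasure \<nu> A \<le> \<infinity> * emeasure \<mu> A"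
    using assms by (cases "emeasure \<mu> A = 0")
      (auto simp: absolutely_continuous_def null_sets_def ennreal_top_mult)
qed fact

lemma dominated_null:
  assumes "dominated c \<nu> \<mu>" "A \<in> sets \<mu>" "emeasure \<mu> A = 0"
  shows "emeasure \<nu> A = 0"
  using dominatedD[OF assms(1,2)] assms(3) by simp

lemma dominated_distr:
  assumes "dominated c \<nu> \<mu>" "f \<in> \<mu> \<rightarrow>\<^sub>M N"
  shows "dominated c (distr \<nu> N f) (distr \<mu> N f)"
proof (rule dominatedI)
  have sets: "sets \<nu> = sets \<mu>" and space: "space \<nu> = space \<mu>"
    using assms(1) by (auto simp: dominated_def dest: sets_eq_imp_space_eq)
  then have f: "f \<in> \<nu> \<rightarrow>\<^sub>M N"
    using assms(2) measurable_cong_sets by blast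
  fix A assume "A \<in> sets (distr \<mu> N f)"
  then show "emeasure (distr \<nu> N f) A \<le> c * emeasure (distr \<mu> N f) A"
    using assms f dominatedD[OF assms(1), of "f -` A \<inter> space \<mu>"]
    by (simp add: emeasure_distr space measurable_sets)
qed simp

section \<open>Domination of product measures\<close>

text \<open>By Tonelli the product measure integrates the measures of the sections over the common
  factor \<open>L\<close>. The bound holds for each section, and the constant leaves the integral
  even when it is \<open>\<infinity>\<close>.\<close>

lemma dominated_pair:
  assumes dom: "dominated c \<nu> \<mu>" and "prob_space \<nu>" "prob_space \<mu>" "prob_space L"
  shows "dominated c (\<nu> \<Otimes>\<^sub>M L) (\<mu> \<Otimes>\<^sub>M L)"
proof (rule dominatedI)
  interpret \<nu>: prob_space \<nu> by fact
  interpret \<mu>: prob_space \<mu> by fact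
  interpret L: prob_space L by fact
  interpret \<nu>L: pair_sigma_finite \<nu> L ..
  interpret \<mu>L: pair_sigma_finite \<mu> L ..
  show sets: "sets (\<nu> \<Otimes>\<^sub>M L) = sets (\<mu> \<Otimes>\<^sub>M L)"
    by (intro sets_pair_measure_cong dominated_sets[OF dom] refl)
  fix A assume A: "A \<in> sets (\<mu> \<Otimes>\<^sub>M L)"
  have "emeasure (\<nu> \<Otimes>\<^sub>M L) A = (\<integral>\<^sup>+y. emeasure \<nu> ((\<lambda>x. (x, y)) -` A) \<partial>L)"
    using A sets by (intro \<nu>L.emeasure_pair_measure_alt2) simp
  also have "\<dots> \<le> (\<integral>\<^sup>+y. c * emeasure \<mu> ((\<lambda>x. (x, y)) -` A) \<partial>L)"
    using A by (intro nn_integral_mono dominatedD[OF dom] sets_Pair2)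
  also have "\<dots> = c * emeasure (\<mu> \<Otimes>\<^sub>M L) A"
    using A by (simp add: nn_integral_cmult \<mu>L.measurable_emeasure_Pair2 \<mu>L.emeasure_pair_measure_alt2)
  finally show "emeasure (\<nu> \<Otimes>\<^sub>M L) A \<le> c * emeasure (\<mu> \<Otimes>\<^sub>M L) A" .
qed

text \<open>Both products are images, under the same insertion map, of coordinate \<open>j\<close>
  paired with the remaining coordinates. The pair case and stability under image measures then
  suffice, even for infinite \<open>I\<close>.\<close>

lemma dominated_PiM_upd:
  assumes prob: "\<And>i. i \<in> I \<Longrightarrow> prob_space (M i)" and "prob_space \<nu>"
    and j: "j \<in> I" and dom: "dominated c \<nu> (M j)"
  shows "dominated c (PiM I (M(j := \<nu>))) (PiM I M)"
proof -
  define J where "J = I - {j}"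
  have I: "I = insert j J"
    using j by (auto simp: J_def)
  let ?N = "M(j := \<nu>)"
  let ?f = "\<lambda>(x, X). X(j := x)"
  have J: "PiM J ?N = PiM J M"
    by (rule PiM_cong) (auto simp: J_def)
  have sets_eq: "sets (PiM I ?N) = sets (PiM I M)"
    using dominated_sets[OF dom] by (intro sets_PiM_cong) auto
  have "dominated c (\<nu> \<Otimes>\<^sub>M PiM J M) (M j \<Otimes>\<^sub>M PiM J M)"
    using prob assms(2) j by (intro dominated_pair[OF dom] prob_space_PiM) (auto simp: J_def)
  moreover have "?f \<in> (M j \<Otimes>\<^sub>M PiM J M) \<rightarrow>\<^sub>M PiM I M"
    unfolding I by measurable
  ultimately have "dominated c (distr (\<nu> \<Otimes>\<^sub>M PiM J M) (PiM I M) ?f)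
      (distr (M j \<Otimes>\<^sub>M PiM J M) (PiM I M) ?f)"
    by (rule dominated_distr)
  moreover have "distr (M j \<Otimes>\<^sub>M PiM J M) (PiM I M) ?f = PiM I M"
    unfolding I using prob j by (intro distr_pair_PiM_eq_PiM) (auto simp: J_def)
  moreover have "distr (\<nu> \<Otimes>\<^sub>M PiM J M) (PiM I M) ?f = PiM I ?N"
  proof -
    have "distr (?N j \<Otimes>\<^sub>M PiM J ?N) (PiM I ?N) ?f = PiM I ?N"
      unfolding I using prob assms(2) by (intro distr_pair_PiM_eq_PiM) (auto simp: J_def)
    then show ?thesis
      \<comment> \<open>The target space of \<open>distr\<close> matters only through its sets, so
        \<open>PiM I M\<close> and \<open>PiM I ?N\<close> are interchangeable there.\<close>
      by (simp only: fun_upd_same J distr_cong[OF refl sets_eq refl])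
  qed
  ultimately show ?thesis
    by simp
qed

text \<open>The factors in \<open>J\<close> are exchanged one at a time, each at the price of one
  factor \<open>c\<close>; the other factors stay as they are.\<close>

lemma dominated_PiM:
  assumes M: "\<And>i. i \<in> I \<Longrightarrow> prob_space (M i)" and N: "\<And>i. i \<in> J \<Longrightarrow> prob_space (N i)"
    and "finite J" "J \<subseteq> I" and dom: "\<And>i. i \<in> J \<Longrightarrow> dominated c (N i) (M i)"
  shows "dominated (c ^ card J) (PiM I (\<lambda>i. if i \<in> J then N i else M i)) (PiM I M)"
  using assms(3,4) N dom
proof (induction J)
  case empty
  then show ?case
    by (simp add: dominated_refl)
next
  case (insert j J)
  let ?K = "\<lambda>i. if i \<in> J then N i else M i"
  have "dominated c (PiM I (?K(j := N j))) (PiM I ?K)"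
    using insert M by (intro dominated_PiM_upd) auto
  moreover have "?K(j := N j) = (\<lambda>i. if i \<in> insert j J then N i else M i)"
    by auto
  moreover have "dominated (c ^ card J) (PiM I ?K) (PiM I M)"
    using insert by auto
  ultimately show ?case
    using insert.hyps by (auto dest: dominated_trans)
qed

section \<open>Laws on the canonical space\<close>

lemma prob_space_uniform01: "prob_space uniform01"
  unfolding uniform01_def by (rule prob_space_uniform_measure) simp_all

text \<open>With \<open>T\<close> free, the iid law can be read with the change point of the law it
  is compared to, so facts about \<open>change_law\<close> serve both.\<close>

lemma iid_law_eq_change_law: "iid_law P = change_law P T P"
  by (simp add: iid_law_def change_law_def)

lemma sets_change_law:
  assumes "sets P = sets X" "sets Q = sets X"
  shows "sets (change_law P T Q) = sets (canonical_space X)"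
  unfolding change_law_def canonical_space_def uniform01_def using assms
  by (intro sets_PiM_cong sets_pair_measure_cong) auto

lemma prob_space_change_law:
  assumes "prob_space P" "prob_space Q"
  shows "prob_space (change_law P T Q)"
  unfolding change_law_def using assms
  by (intro prob_space_PiM prob_space_pair prob_space_uniform01) auto

text \<open>Indices start at 1, so exactly \<open>T\<close> coordinates carry the pre-change law,
  and the randomizers do not affect the constant.\<close>

lemma dominated_change_law:
  assumes "dominated c P P'" "prob_space P" "prob_space P'" "prob_space Q"
  shows "dominated (c ^ T) (change_law P T Q) (change_law P' T Q)"
proof -
  let ?M = "\<lambda>n. (if n \<le> T then P' else Q) \<Otimes>\<^sub>M uniform01"
  have "dominated (c ^ card {1..T})
      (PiM {1..} (\<lambda>n. if n \<in> {1..T} then P \<Otimes>\<^sub>M uniform01 else ?M n)) (PiM {1..} ?M)"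
    using assms
    by (intro dominated_PiM prob_space_pair prob_space_uniform01) (auto intro!: dominated_pair prob_space_uniform01)
  also have "PiM {1..} (\<lambda>n. if n \<in> {1..T} then P \<Otimes>\<^sub>M uniform01 else ?M n) = change_law P T Q"
    unfolding change_law_def by (rule PiM_cong) auto
  finally show ?thesis
    by (simp add: change_law_def)
qed

section \<open>Mixtures as perturbations of a law\<close>

text \<open>The summand with weight \<open>t\<close> alone already gives the bound.\<close>

lemma dominated_mixture:
  assumes "sets Q = sets P" "0 < t"
  shows "dominated (ennreal (1 / t)) P (mixture t P Q)"
proof (rule dominatedI)
  fix A assume "A \<in> sets (mixture t P Q)"
  then have A: "A \<in> sets P"
    by simp
  have "emeasure P A = ennreal (1 / t) * (ennreal t * emeasure P A)"
    using assms(2) by (simp flip: mult.assoc ennreal_mult)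
  also have "\<dots> \<le> ennreal (1 / t) * emeasure (mixture t P Q) A"
    by (simp add: emeasure_mixture[OF assms(1) A] mult_left_mono)
  finally show "emeasure P A \<le> ennreal (1 / t) * emeasure (mixture t P Q) A" .
qed simp

text \<open>Keeps the mixture eligible for the infimum over \<open>\<M> - {P0}\<close>. Equality
  would force \<open>(1 - t) * (Q A - P A) = 0\<close> for every event \<open>A\<close>.\<close>

lemma mixture_neq:
  assumes "prob_space P" "prob_space Q" "sets Q = sets P" "0 < t" "t < 1" "Q \<noteq> P"
  shows "mixture t P Q \<noteq> P"
proof
  interpret P: prob_space P by fact
  interpret Q: prob_space Q by fact
  assume eq: "mixture t P Q = P"
  have "Q = P"
  proof (rule measure_eqI)
    fix A assume "A \<in> sets Q"
    then have "ennreal t * emeasure P A + ennreal (1 - t) * emeasure Q A = emeasure P A"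
      using emeasure_mixture[of Q P A t] assms(3) eq by simp
    \<comment> \<open>The equation moves to the reals, where terms can be cancelled.\<close>
    then have "ennreal (t * measure P A + (1 - t) * measure Q A) = ennreal (measure P A)"
      using assms by (simp add: P.emeasure_eq_measure Q.emeasure_eq_measure ennreal_mult' ennreal_plus)
    then have "t * measure P A + (1 - t) * measure Q A = measure P A"
      using assms by (subst (asm) ennreal_inj) auto
    then have "(1 - t) * (measure Q A - measure P A) = 0"
      by (simp add: algebra_simps)
    then show "emeasure Q A = emeasure P A"
      using assms by (simp add: P.emeasure_eq_measure Q.emeasure_eq_measure)
  qed fact
  then show False
    using assms(6) by simp
qed

section \<open>Stopping times and Ville's inequality\<close>

lemma ext_stopping_time_finite_sets:
  assumes "ext_stopping_time F \<tau>" "\<And>n. subalgebra M (F n)"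
  shows "{\<omega> \<in> space M. \<tau> \<omega> < \<infinity>} \<in> sets M"
proof -
  have "{\<omega> \<in> space M. \<tau> \<omega> \<le> enat n} \<in> sets M" for n
    using assms(1)[unfolded ext_stopping_time_def, rule_format, of n] assms(2)[of n]
    by (auto simp: pred_def subalgebra_def)
  then have "(\<Union>n. {\<omega> \<in> space M. \<tau> \<omega> \<le> enat n}) \<in> sets M"
    by blast
  also have "(\<Union>n. {\<omega> \<in> space M. \<tau> \<omega> \<le> enat n}) = {\<omega> \<in> space M. \<tau> \<omega> < \<infinity>}"
  proof -
    have "(\<exists>n. x \<le> enat n) \<longleftrightarrow> x < \<infinity>" for x
      by (cases x) auto
    then show ?thesis
      by auto
  qed
  finally show ?thesis .
qed

text \<open>Stop when \<open>E\<close> first reaches \<open>c\<close>, at the latest at time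
  \<open>N\<close>. The assumed bound at this bounded stopping time takes the place of optional
  stopping, and Markov's inequality finishes.\<close>

lemma ville_inequality:
  fixes E :: "nat \<Rightarrow> 'b \<Rightarrow> ennreal" and c :: real
  assumes "filtration (space M) F" "\<And>n. subalgebra M (F n)"
    and E: "\<And>n. E n \<in> borel_measurable (F n)"
    and bound: "\<And>\<sigma>. stopping_time F \<sigma> \<Longrightarrow> (\<exists>N. \<forall>\<omega>\<in>space M. \<sigma> \<omega> \<le> N) \<Longrightarrow> (\<integral>\<^sup>+\<omega>. E (\<sigma> \<omega>) \<omega> \<partial>M) \<le> 1"
    and "0 < c"
  shows "emeasure M {\<omega> \<in> space M. \<exists>n\<le>N. ennreal c \<le> E n \<omega>} \<le> ennreal (1 / c)"
proof -
  interpret filtration "space M" F by fact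
  \<comment> \<open>The alternative \<open>n = N\<close> makes the set nonempty, so that
    \<open>LEAST\<close> is meaningful, and bounds the time by \<open>N\<close>.\<close>
  define \<sigma> where "\<sigma> \<omega> = (LEAST n. n = N \<or> ennreal c \<le> E n \<omega>)" for \<omega>
  have \<sigma>: "\<sigma> \<omega> = N \<or> ennreal c \<le> E (\<sigma> \<omega>) \<omega>" for \<omega>
    unfolding \<sigma>_def by (rule LeastI[of _ N]) simp
  have \<sigma>_le: "\<sigma> \<omega> \<le> n" if "n = N \<or> ennreal c \<le> E n \<omega>" for n \<omega>
    unfolding \<sigma>_def using that by (rule Least_le)
  have stop: "stopping_time F \<sigma>"
  proof
    fix t
    \<comment> \<open>Whether stopping has occurred by \<open>t\<close> depends only on
      \<open>E 0, ..., E t\<close>, all of them \<open>F t\<close>-measurable.\<close>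
    have "\<sigma> \<omega> \<le> t \<longleftrightarrow> N \<le> t \<or> (\<exists>n\<in>{..t}. ennreal c \<le> E n \<omega>)" for \<omega>
      using \<sigma>[of \<omega>] \<sigma>_le[of _ \<omega>] by (metis atMost_iff order_trans)
    moreover have [measurable]: "E n \<in> borel_measurable (F t)" if "n \<in> {..t}" for n
      using measurable_from_subalg[of "F t" "F n" "E n"] E sets_F_mono that
      by (auto simp: subalgebra_def space_F)
    ultimately show "Measurable.pred (F t) (\<lambda>\<omega>. \<sigma> \<omega> \<le> t)"
      by (simp only:) measurable
  qed
  have [measurable]: "E n \<in> borel_measurable M" for n
    using measurable_from_subalg assms(2) E by blast
  have "\<sigma> \<in> borel_measurable M"
    using assms(2) by (intro measurable_stopping_time[OF stop]) (auto simp: subalgebra_def)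
  \<comment> \<open>Discrete measurability of the time lets
    \<open>E (\<sigma> \<omega>) \<omega>\<close> be treated as a countable case
    distinction.\<close>
  then have [measurable]: "\<sigma> \<in> M \<rightarrow>\<^sub>M count_space UNIV"
    by (simp add: measurable_cong_sets[OF refl sets_borel_eq_count_space])
  have [measurable]: "(\<lambda>\<omega>. E (\<sigma> \<omega>) \<omega>) \<in> borel_measurable M"
    by measurable
  have "ennreal c \<le> E (\<sigma> \<omega>) \<omega>" if n: "n \<le> N" "ennreal c \<le> E n \<omega>" for n \<omega>
    using \<sigma>[of \<omega>] \<sigma>_le[of n \<omega>] n by auto
  \<comment> \<open>Rescales the event to the threshold 1 used in
    \<open>nn_integral_Markov_inequality\<close>.\<close>
  moreover have "1 \<le> ennreal (1 / c) * x \<longleftrightarrow> ennreal c \<le> x" for x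
  proof (cases x)
    case (real r)
    then show ?thesis
      using \<open>0 < c\<close> by (auto simp: field_simps simp flip: ennreal_mult' ennreal_1)
  next
    case top
    then show ?thesis
      using \<open>0 < c\<close> by (simp add: ennreal_mult_top)
  qed
  ultimately have "emeasure M {\<omega> \<in> space M. \<exists>n\<le>N. ennreal c \<le> E n \<omega>}
      \<le> emeasure M {\<omega> \<in> space M. 1 \<le> ennreal (1 / c) * E (\<sigma> \<omega>) \<omega>}"
    by (intro emeasure_mono) auto
  also have "\<dots> \<le> ennreal (1 / c) * (\<integral>\<^sup>+\<omega>. E (\<sigma> \<omega>) \<omega> * indicator (space M) \<omega> \<partial>M)"
    by (rule nn_integral_Markov_inequality) measurable
  also have "\<dots> = ennreal (1 / c) * (\<integral>\<^sup>+\<omega>. E (\<sigma> \<omega>) \<omega> \<partial>M)"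
    by (intro arg_cong[where f = "(*) _"] nn_integral_cong) simp
  also have "\<dots> \<le> ennreal (1 / c) * 1"
    using stop \<sigma>_le by (intro mult_left_mono bound) auto
  finally show ?thesis
    by simp
qed

text \<open>An infinite supremum means that every level \<open>c\<close> is reached. Continuity from
  below in \<open>N\<close> gives the bound \<open>1 / c\<close>, which vanishes as \<open>c\<close>
  grows.\<close>

lemma ville_null:
  fixes E :: "nat \<Rightarrow> 'b \<Rightarrow> ennreal"
  assumes "filtration (space M) F" "\<And>n. subalgebra M (F n)"
    and E: "\<And>n. E n \<in> borel_measurable (F n)"
    and bound: "\<And>\<sigma>. stopping_time F \<sigma> \<Longrightarrow> (\<exists>N. \<forall>\<omega>\<in>space M. \<sigma> \<omega> \<le> N) \<Longrightarrow> (\<integral>\<^sup>+\<omega>. E (\<sigma> \<omega>) \<omega> \<partial>M) \<le> 1"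
  shows "emeasure M {\<omega> \<in> space M. (SUP n. E n \<omega>) = \<infinity>} = 0"
proof -
  have [measurable]: "E n \<in> borel_measurable M" for n
    using measurable_from_subalg assms(2) E by blast
  have le: "emeasure M {\<omega> \<in> space M. (SUP n. E n \<omega>) = \<infinity>} \<le> ennreal (1 / c)" if "0 < c" for c :: real
  proof -
    let ?A = "\<lambda>N. {\<omega> \<in> space M. \<exists>n\<le>N. ennreal c \<le> E n \<omega>}"
    have "\<exists>n. ennreal c \<le> E n \<omega>" if "(SUP n. E n \<omega>) = \<infinity>" for \<omega>
      using less_SUP_iff[of "ennreal c" "\<lambda>n. E n \<omega>" UNIV] unfolding that
      by (metis ennreal_less_top infinity_ennreal_def less_imp_le)
    then have "{\<omega> \<in> space M. (SUP n. E n \<omega>) = \<infinity>} \<subseteq> (\<Union>N. ?A N)"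
      by blast
    then have "emeasure M {\<omega> \<in> space M. (SUP n. E n \<omega>) = \<infinity>} \<le> emeasure M (\<Union>N. ?A N)"
      by (intro emeasure_mono) measurable
    also have "\<dots> = (SUP N. emeasure M (?A N))"
      by (intro SUP_emeasure_incseq[symmetric]) (auto simp: incseq_def intro: order_trans)
    also have "\<dots> \<le> ennreal (1 / c)"
      using assms that by (intro SUP_least ville_inequality) auto
    finally show ?thesis .
  qed
  have "((\<lambda>c::real. ennreal (1 / c)) \<longlongrightarrow> ennreal 0) at_top"
    by (intro tendsto_ennrealI tendsto_divide_0[OF tendsto_const] filterlim_at_top_imp_at_infinity filterlim_ident)
  then have "emeasure M {\<omega> \<in> space M. (SUP n. E n \<omega>) = \<infinity>} \<le> ennreal 0"
    by (rule tendsto_lowerbound) (use le in \<open>auto intro: eventually_mono[OF eventually_gt_at_top[of 0]]\<close>)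
  then show ?thesis
    by simp
qed

section \<open>Transfer between the change-point law and the iid laws\<close>

theorem proposition3p1:
  fixes X :: "'a measure"
    and \<M> :: "'a measure set"
    and T :: nat
    and F :: "nat \<Rightarrow> (nat \<Rightarrow> 'a \<times> real) measure"
  assumes "\<M> \<subseteq> space (prob_algebra X)"
    and "convex_class \<M>"
    and "\<exists>P\<in>\<M>. \<exists>Q\<in>\<M>. P \<noteq> Q"
    and "filtration (space (canonical_space X)) F"
    and "\<And>n. subalgebra (canonical_space X) (F n)"
  shows
    "(\<forall>(\<alpha>::real) (\<tau> :: (nat \<Rightarrow> 'a \<times> real) \<Rightarrow> enat).
        0 \<le> \<alpha> \<and> \<alpha> < 1 \<and> ext_stopping_time F \<tau> \<and>
        (SUP P\<in>\<M>. \<P>(\<omega> in iid_law P. \<tau> \<omega> < \<infinity>)) \<le> \<alpha> \<longrightarrow>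
          (\<forall>P0\<in>\<M>. (INF P1\<in>\<M> - {P0}. \<P>(\<omega> in change_law P0 T P1. \<tau> \<omega> < \<infinity>)) \<le> \<alpha>) \<and>
          (\<forall>P0\<in>\<M>. \<forall>P1\<in>\<M>. absolutely_continuous P0 P1 \<longrightarrow>
             \<P>(\<omega> in change_law P0 T P1. \<tau> \<omega> < \<infinity>) < 1))
     \<and>
     (\<forall>E :: nat \<Rightarrow> (nat \<Rightarrow> 'a \<times> real) \<Rightarrow> ennreal.
        (\<forall>n. E n \<in> borel_measurable (F n)) \<and>
        (\<forall>P\<in>\<M>. \<forall>\<sigma> :: (nat \<Rightarrow> 'a \<times> real) \<Rightarrow> nat.
           stopping_time F \<sigma> \<and> (\<exists>N. \<forall>\<omega>\<in>space (canonical_space X). \<sigma> \<omega> \<le> N) \<longrightarrow>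
             (\<integral>\<^sup>+ \<omega>. E (\<sigma> \<omega>) \<omega> \<partial>iid_law P) \<le> 1) \<longrightarrow>
          (\<forall>P0\<in>\<M>. \<forall>P1\<in>\<M>. absolutely_continuous P1 P0 \<longrightarrow>
             \<P>(\<omega> in change_law P0 T P1. (SUP n. E n \<omega>) < \<infinity>) = 1))"
proof -
  have prob: "prob_space P" and sets_M: "sets P = sets X" if "P \<in> \<M>" for P
    using assms(1) that by (auto simp: space_prob_algebra)
  have prob_change: "prob_space (change_law P T Q)" if "P \<in> \<M>" "Q \<in> \<M>" for P Q
    using that by (intro prob_space_change_law prob)
  have sets: "sets (change_law P T Q) = sets (canonical_space X)" if "P \<in> \<M>" "Q \<in> \<M>" for P Q
    using that by (intro sets_change_law sets_M)
  have space: "space (change_law P T Q) = space (canonical_space X)" if "P \<in> \<M>" "Q \<in> \<M>" for P Q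
    using that by (intro sets_eq_imp_space_eq sets)
  \<comment> \<open>\<open>R\<close> is the common post-change law. For \<open>R = Q\<close> the
    right-hand law is iid, for \<open>R = P\<close> the left-hand one; both directions occur
    below.\<close>
  have dom: "dominated (c ^ T) (change_law P T R) (change_law Q T R)"
    if "P \<in> \<M>" "Q \<in> \<M>" "R \<in> \<M>" "dominated c P Q" for c P Q R
    using that by (intro dominated_change_law prob)

  have inf_le: "(INF P1\<in>\<M> - {P0}. \<P>(\<omega> in change_law P0 T P1. \<tau> \<omega> < \<infinity>)) \<le> \<alpha>"
    and less_1: "P1 \<in> \<M> \<Longrightarrow> absolutely_continuous P0 P1 \<Longrightarrow> \<P>(\<omega> in change_law P0 T P1. \<tau> \<omega> < \<infinity>) < 1"
    if \<alpha>: "0 \<le> \<alpha>" "\<alpha> < 1" and \<tau>: "ext_stopping_time F \<tau>"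
      and Sup: "(SUP P\<in>\<M>. \<P>(\<omega> in iid_law P. \<tau> \<omega> < \<infinity>)) \<le> \<alpha>" and P0: "P0 \<in> \<M>" for \<alpha> :: real and \<tau> P0 P1
  proof -
    let ?A = "{\<omega> \<in> space (canonical_space X). \<tau> \<omega> < \<infinity>}"
    have A: "?A \<in> sets (canonical_space X)"
      using \<tau> assms(5) by (rule ext_stopping_time_finite_sets)
    have iid: "measure (change_law P T P) ?A \<le> \<alpha>" if P: "P \<in> \<M>" for P
    proof -
      have "measure (change_law P T P) ?A = \<P>(\<omega> in iid_law P. \<tau> \<omega> < \<infinity>)"
        using space[OF P P] by (simp add: iid_law_eq_change_law[of P T])
      \<comment> \<open>A real supremum bounds its members only if the family is bounded above, here
        by 1.\<close>
      also have "\<dots> \<le> (SUP P\<in>\<M>. \<P>(\<omega> in iid_law P. \<tau> \<omega> < \<infinity>))"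
        using P prob_change
        by (intro cSUP_upper bdd_aboveI2[where M = 1])
          (auto simp: iid_law_eq_change_law[of _ T] intro: prob_space.prob_le_1)
      finally show ?thesis
        using Sup by simp
    qed
    show "(INF P1\<in>\<M> - {P0}. \<P>(\<omega> in change_law P0 T P1. \<tau> \<omega> < \<infinity>)) \<le> \<alpha>" (is "?I \<le> \<alpha>")
    proof -
      obtain Q where Q: "Q \<in> \<M>" "Q \<noteq> P0"
        using assms(3) by metis
      have le: "?I \<le> (1 / t) ^ T * \<alpha>" if t: "0 < t" "t < 1" for t :: real
      proof -
        \<comment> \<open>\<open>R\<close> lies in the class by convexity and is close to
          \<open>P0\<close> for \<open>t\<close> near 1. Replacing \<open>P0\<close> by
          \<open>R\<close> before the change costs at most \<open>(1 / t) ^ T\<close> and yields the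
          iid law of \<open>R\<close>.\<close>
        define R where "R = mixture t P0 Q"
        have R: "R \<in> \<M>"
          unfolding R_def using assms(2) P0 Q t by (auto simp: convex_class_def)
        interpret C: prob_space "change_law P0 T R"
          using P0 R by (rule prob_change)
        interpret D: prob_space "change_law R T R"
          using R R by (rule prob_change)
        have "R \<noteq> P0"
          unfolding R_def using P0 Q t by (intro mixture_neq prob) (auto simp: sets_M)
        then have "?I \<le> \<P>(\<omega> in change_law P0 T R. \<tau> \<omega> < \<infinity>)"
          using R by (intro cINF_lower bdd_belowI2[where m = 0]) auto
        also have "\<dots> = measure (change_law P0 T R) ?A"
          using P0 R by (simp add: space)
        also have "\<dots> \<le> (1 / t) ^ T * measure (change_law R T R) ?A"
        proof -
          have "dominated (ennreal (1 / t)) P0 R"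
            unfolding R_def using P0 Q t by (intro dominated_mixture) (auto simp: sets_M)
          then have "dominated (ennreal (1 / t) ^ T) (change_law P0 T R) (change_law R T R)"
            using P0 R by (intro dom)
          then have "emeasure (change_law P0 T R) ?A \<le> ennreal (1 / t) ^ T * emeasure (change_law R T R) ?A"
            using A R by (intro dominatedD) (auto simp: sets)
          then show ?thesis
            using t by (simp add: C.emeasure_eq_measure D.emeasure_eq_measure ennreal_power
                flip: ennreal_mult)
        qed
        also have "\<dots> \<le> (1 / t) ^ T * \<alpha>"
          using iid[OF R] t by (intro mult_left_mono) auto
        finally show ?thesis .
      qed
      \<comment> \<open>The value \<open>t = 1\<close> would give \<open>P0\<close> itself, which
        the infimum excludes; hence the limit from the left.\<close>
      have "((\<lambda>t. (1 / t) ^ T * \<alpha>) \<longlongrightarrow> (1 / 1) ^ T * \<alpha>) (at_left (1::real))"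
        by (intro tendsto_intros) simp
      moreover have "\<forall>\<^sub>F t in at_left (1::real). ?I \<le> (1 / t) ^ T * \<alpha>"
        unfolding eventually_at_left_field by (intro exI[of _ 0]) (use le in auto)
      ultimately have "?I \<le> (1 / 1) ^ T * \<alpha>"
        by (rule tendsto_lowerbound) simp
      then show ?thesis
        by simp
    qed
    show "\<P>(\<omega> in change_law P0 T P1. \<tau> \<omega> < \<infinity>) < 1"
      if P1: "P1 \<in> \<M>" and ac: "absolutely_continuous P0 P1"
    proof (rule ccontr)
      interpret C: prob_space "change_law P0 T P1"
        using P0 P1 by (rule prob_change)
      interpret D: prob_space "change_law P1 T P1"
        using P1 P1 by (rule prob_change)
      assume "\<not> \<P>(\<omega> in change_law P0 T P1. \<tau> \<omega> < \<infinity>) < 1"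
      then have "C.prob ?A = 1"
        using C.prob_le_1[of ?A] unfolding space[OF P0 P1] by linarith
      then have "emeasure (change_law P0 T P1) (space (canonical_space X) - ?A) = 0"
        using A C.prob_compl[of ?A] P0 P1 by (simp add: sets space C.emeasure_eq_measure)
      \<comment> \<open>Here the change-point law dominates the iid law, so the null set of never
        stopping passes to the iid law of \<open>P1\<close>. This contradicts the bound
        \<open>\<alpha> < 1\<close>. For \<open>T = 0\<close> the factor is 1 and the two laws
        coincide.\<close>
      moreover have "dominated (\<infinity> ^ T) (change_law P1 T P1) (change_law P0 T P1)"
        using P0 P1 ac by (intro dom dominated_top_if_absolutely_continuous) (auto simp: sets_M)
      ultimately have "emeasure (change_law P1 T P1) (space (canonical_space X) - ?A) = 0"
        using A P0 P1 by (intro dominated_null[of _ "change_law P1 T P1"]) (auto simp: sets)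
      then have "D.prob ?A = 1"
        using A D.prob_compl[of ?A] P1 by (simp add: sets space D.emeasure_eq_measure)
      then show False
        using iid[OF P1] \<alpha> by simp
    qed
  qed

  have "\<P>(\<omega> in change_law P0 T P1. (SUP n. E n \<omega>) < \<infinity>) = 1"
    if E: "\<And>n. E n \<in> borel_measurable (F n)"
      and bound: "\<And>P \<sigma>. P \<in> \<M> \<Longrightarrow> stopping_time F \<sigma> \<Longrightarrow>
        (\<exists>N. \<forall>\<omega>\<in>space (canonical_space X). \<sigma> \<omega> \<le> N) \<Longrightarrow> (\<integral>\<^sup>+ \<omega>. E (\<sigma> \<omega>) \<omega> \<partial>iid_law P) \<le> 1"
      and P: "P0 \<in> \<M>" "P1 \<in> \<M>" and ac: "absolutely_continuous P1 P0"
    for E :: "nat \<Rightarrow> (nat \<Rightarrow> 'a \<times> real) \<Rightarrow> ennreal" and P0 P1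
  proof -
    let ?B = "{\<omega> \<in> space (canonical_space X). (SUP n. E n \<omega>) = \<infinity>}"
    interpret C: prob_space "change_law P0 T P1"
      using P by (rule prob_change)
    have [measurable]: "E n \<in> borel_measurable (canonical_space X)" for n
      using measurable_from_subalg assms(5) E by blast
    have B: "?B \<in> sets (canonical_space X)"
      by measurable
    \<comment> \<open>Ville's inequality is applied under the iid law of \<open>P1\<close>, the only
      one of the two laws under which the expectation bound is assumed.\<close>
    have "emeasure (change_law P1 T P1) {\<omega> \<in> space (change_law P1 T P1). (SUP n. E n \<omega>) = \<infinity>} = 0"
      using assms(4,5) bound[OF P(2)] E P
      by (intro ville_null[of _ F])
        (auto simp: space sets subalgebra_def iid_law_eq_change_law[of _ T])
    then have "emeasure (change_law P1 T P1) ?B = 0"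
      using P by (simp add: space)
    \<comment> \<open>Now the iid law dominates, which is why absolute continuity is required in the
      opposite direction.\<close>
    moreover have "dominated (\<infinity> ^ T) (change_law P0 T P1) (change_law P1 T P1)"
      using P ac by (intro dom dominated_top_if_absolutely_continuous) (auto simp: sets_M)
    ultimately have "emeasure (change_law P0 T P1) ?B = 0"
      using B P by (intro dominated_null[of _ "change_law P0 T P1"]) (auto simp: sets)
    then have "C.prob (space (change_law P0 T P1) - ?B) = 1"
      using B P by (subst C.prob_compl) (auto simp: sets C.emeasure_eq_measure)
    moreover have "space (change_law P0 T P1) - ?B = {\<omega> \<in> space (change_law P0 T P1). (SUP n. E n \<omega>) < \<infinity>}"
      unfolding space[OF P] infinity_ennreal_def top.not_eq_extremum[symmetric] by blast
    ultimately show ?thesis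
      by simp
  qed
  then show ?thesis
    using inf_le less_1 by auto
qed

end
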